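(* Let $\mathcal H_\alpha=\mathcal H_{n,q,N,\nu,\alpha}$ be the Hopf algebra over the field $k$ defined in the context, and assume that $k$ contains a primitive $N$th root of unity. If $\alpha=0$ then $|G(\mathcal H_0^* )|=N$. If $\alpha\ne0$ then $|G(\mathcal H_\alpha^* )|=\#\{0\le i\le N-1\mid N \text{ divides } \nu n i\}$.
   Context: Let $k$ be a field; $(b,c)$ denotes the greatest common divisor of integers $b,c$. $G(H)$ is the group of grouplike elements of a Hopf algebra $H$. Let $n,\nu,N$ be positive integers with $n\mid N$, $1\le\nu<N$; let $q\in k$ be a primitive $n$th root of unity and $r=|q^\nu|$ the multiplicative order of $q^\nu$. For $\alpha=0$, $\mathcal H_0=\mathcal H_{n,q,N,\nu,0}=H_{n,q,N,\nu}$ is the Hopf algebra generated as an algebra by $a,x$ with relations $a^N=1$, $x^r=0$, $xa=qax$, and with $\Delta(a)=a\otimes a$, $\Delta(x)=x\otimes a^\nu+1\otimes x$, $\varepsilon(a)=1$, $\varepsilon(x)=0$, antipode $s(a)=a^{-1}$, $s(x)=-q^{-\nu}a^{-\nu}x$. For $0\ne\alpha\in k$ one further assumes $(n,\nu)=1$ (hence $r=n$), $n>1$ and $N\nmid\nu n$; then $\mathcal H_\alpha=\mathcal H_{n,q,N,\nu,\alpha}$ is generated as an algebra by $a,x$ with relations $a^N=1$, $x^n=\alpha(a^{\nu n}-1)$, $xa=qax$, with the same formulas for $\Delta,\varepsilon,s$ on $a,x$. *)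

theory Defs
  imports
    "HOL-Algebra.Module"
    "HOL-Algebra.QuotRing"
    "HOL-Library.Poly_Mapping"
    "HOL.Vector_Spaces"
begin

section \<open>Roots of unity\<close>

definition primitive_root_of_unity :: "nat \<Rightarrow> 'k::field \<Rightarrow> bool" where
  "primitive_root_of_unity n z \<longleftrightarrow> 0 < n \<and> z ^ n = 1 \<and> (\<forall>m. 0 < m \<and> m < n \<longrightarrow> z ^ m \<noteq> 1)"

definition mult_order :: "'k::field \<Rightarrow> nat" where
  "mult_order z = (LEAST m. 0 < m \<and> z ^ m = 1)"


section \<open>Algebras over a field\<close>

text \<open>
  The ground field is a type of class \<^class>\<open>field\<close>. Vector spaces and (not necessarily
  commutative) algebras over it are records of type \<^typ>\<open>('k, 'v) module\<close>; where only the
  vector space structure matters, \<open>mult\<close> and \<open>one\<close> are ignored.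
\<close>

definition type_algebra :: "('k \<Rightarrow> 'v \<Rightarrow> 'v) \<Rightarrow> ('k::field, 'v::ring_1) module" where
  "type_algebra scale =
    \<lparr>carrier = UNIV, mult = (*), one = 1, zero = 0, add = (+), smult = scale\<rparr>"

definition opposite_algebra :: "('k, 'v, 'm) module_scheme \<Rightarrow> ('k, 'v, 'm) module_scheme" where
  "opposite_algebra A = A\<lparr>mult := \<lambda>u v. v \<otimes>\<^bsub>A\<^esub> u\<rparr>"

text \<open>The quotient of an algebra by a two-sided ideal: the library's quotient ring \<open>A Quot I\<close>
  together with its scalar multiplication.\<close>

definition quotient_algebra ::
    "('k, 'v, 'm) module_scheme \<Rightarrow> 'v set \<Rightarrow> ('k, 'v set) module" where
  "quotient_algebra A I =
    \<lparr>carrier = carrier (A Quot I), mult = mult (A Quot I), one = one (A Quot I),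
     zero = zero (A Quot I), add = add (A Quot I),
     smult = (\<lambda>c C. \<Union>u\<in>C. I +>\<^bsub>A\<^esub> (c \<odot>\<^bsub>A\<^esub> u))\<rparr>"

definition linear_form :: "('k::field, 'v, 'm) module_scheme \<Rightarrow> ('v \<Rightarrow> 'k) \<Rightarrow> bool" where
  "linear_form V f \<longleftrightarrow>
    (\<forall>u\<in>carrier V. \<forall>v\<in>carrier V. f (u \<oplus>\<^bsub>V\<^esub> v) = f u + f v) \<and>
    (\<forall>c. \<forall>v\<in>carrier V. f (c \<odot>\<^bsub>V\<^esub> v) = c * f v)"

definition bilinear_form ::
    "('k::field, 'v, 'm) module_scheme \<Rightarrow> ('k, 'w, 'n) module_scheme \<Rightarrow> ('v \<Rightarrow> 'w \<Rightarrow> 'k) \<Rightarrow> bool" where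
  "bilinear_form V W B \<longleftrightarrow>
    (\<forall>w\<in>carrier W. linear_form V (\<lambda>v. B v w)) \<and> (\<forall>v\<in>carrier V. linear_form W (B v))"


section \<open>Tensor products\<close>

text \<open>
  The tensor product of \<open>V\<close> and \<open>W\<close> is realised inside the dual of the space of bilinear forms on
  \<open>V \<times> W\<close>: the elementary tensor of \<open>v\<close> and \<open>w\<close> is the evaluation \<open>B \<mapsto> B v w\<close>, and the tensor
  product is the span of the elementary tensors. Over a field this has the universal
  property of the tensor product; see \<open>tensor_universal\<close> below.
  Tensors are normalised to be 0 on arguments that are not bilinear forms.
\<close>

type_synonym ('k, 'v, 'w) tensor = "('v \<Rightarrow> 'w \<Rightarrow> 'k) \<Rightarrow> 'k"

definition tens ::
    "('k::field, 'v, 'm) module_scheme \<Rightarrow> ('k, 'w, 'n) module_scheme \<Rightarrow> 'v \<Rightarrow> 'w \<Rightarrow> ('k, 'v, 'w) tensor" where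
  "tens V W v w = (\<lambda>B. if bilinear_form V W B then B v w else 0)"

text \<open>
  The product is determined by \<open>(v \<otimes> w) (v' \<otimes> w') = v v' \<otimes> w w'\<close> on elementary tensors: evaluate
  \<open>t\<close> in the variables \<open>v, w\<close> and \<open>t'\<close> in the variables \<open>v', w'\<close> of \<open>B (v v') (w w')\<close>.
  The carrier needs no scalars, since they can be absorbed in the \<open>v i\<close>.
\<close>

definition tensor_algebra ::
    "('k::field, 'v, 'm) module_scheme \<Rightarrow> ('k, 'w, 'n) module_scheme
      \<Rightarrow> ('k, ('k, 'v, 'w) tensor) module" where
  "tensor_algebra V W =
    \<lparr>carrier = {(\<lambda>B. \<Sum>i<m. tens V W (v i) (w i) B) | (m::nat) v w.
                  (\<forall>i<m. v i \<in> carrier V) \<and> (\<forall>i<m. w i \<in> carrier W)},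
     mult = (\<lambda>t t' B. if bilinear_form V W B
                then t (\<lambda>v w. t' (\<lambda>v' w'. B (v \<otimes>\<^bsub>V\<^esub> v') (w \<otimes>\<^bsub>W\<^esub> w'))) else 0),
     one = tens V W \<one>\<^bsub>V\<^esub> \<one>\<^bsub>W\<^esub>,
     zero = (\<lambda>B. 0),
     add = (\<lambda>t t' B. t B + t' B),
     smult = (\<lambda>c t B. c * t B)\<rparr>"

text \<open>
  Universal property: a bilinear map \<open>\<beta>\<close> from \<open>V \<times> W\<close> to any vector space factors uniquely
  through a linear map on the tensor product.
\<close>

lemma tens_sum_determines_bilinear:
  fixes V :: "('k::field, 'v, 'm) module_scheme"
    and W :: "('k, 'w, 'n) module_scheme"
    and scale :: "'k \<Rightarrow> 'u::ab_group_add \<Rightarrow> 'u"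
    and m m' :: nat
  assumes "vector_space scale"
    and lin1: "\<And>u v w. u \<in> carrier V \<Longrightarrow> v \<in> carrier V \<Longrightarrow> w \<in> carrier W
               \<Longrightarrow> \<beta> (u \<oplus>\<^bsub>V\<^esub> v) w = \<beta> u w + \<beta> v w"
    and lin2: "\<And>v w z. v \<in> carrier V \<Longrightarrow> w \<in> carrier W \<Longrightarrow> z \<in> carrier W
               \<Longrightarrow> \<beta> v (w \<oplus>\<^bsub>W\<^esub> z) = \<beta> v w + \<beta> v z"
    and lin3: "\<And>c v w. v \<in> carrier V \<Longrightarrow> w \<in> carrier W \<Longrightarrow> \<beta> (c \<odot>\<^bsub>V\<^esub> v) w = scale c (\<beta> v w)"
    and lin4: "\<And>c v w. v \<in> carrier V \<Longrightarrow> w \<in> carrier W \<Longrightarrow> \<beta> v (c \<odot>\<^bsub>W\<^esub> w) = scale c (\<beta> v w)"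
    and eq: "(\<lambda>B. \<Sum>i<m. tens V W (v i) (w i) B) = (\<lambda>B. \<Sum>i<m'. tens V W (v' i) (w' i) B)"
  shows "(\<Sum>i<m. \<beta> (v i) (w i)) = (\<Sum>i<m'. \<beta> (v' i) (w' i))"
proof (rule ccontr)
  let ?x = "\<Sum>i<m. \<beta> (v i) (w i)" and ?y = "\<Sum>i<m'. \<beta> (v' i) (w' i)"
  assume ne: "?x \<noteq> ?y"
  interpret U: vector_space scale by fact
  interpret P: vector_space_pair scale "(*) :: 'k \<Rightarrow> 'k \<Rightarrow> 'k"
    by unfold_locales (auto simp: algebra_simps)
  have ind: "\<not> U.dependent {?x - ?y}" using ne by simp
  define \<phi> where "\<phi> = P.construct {?x - ?y} (\<lambda>_. 1)"
  have lin: "Vector_Spaces.linear scale (*) \<phi>"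
    unfolding \<phi>_def by (rule P.linear_construct[OF ind])
  have "\<phi> (?x - ?y) = 1"
    unfolding \<phi>_def by (rule P.construct_basis[OF ind]) simp
  then have neq: "\<phi> ?x \<noteq> \<phi> ?y" using P.linear_diff[OF lin, of ?x ?y] by auto
  have bil: "bilinear_form V W (\<lambda>v w. \<phi> (\<beta> v w))"
    unfolding bilinear_form_def linear_form_def
    by (simp add: lin1 lin2 lin3 lin4 P.linear_add[OF lin] P.linear_scale[OF lin])
  have "\<phi> ?x = \<phi> ?y"
    using fun_cong[OF eq, of "\<lambda>v w. \<phi> (\<beta> v w)"] bil
    by (simp add: tens_def P.linear_sum[OF lin])
  with neq show False by contradiction
qed

lemma tensor_universal:
  fixes V :: "('k::field, 'v, 'm) module_scheme"
    and W :: "('k, 'w, 'n) module_scheme"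
    and scale :: "'k \<Rightarrow> 'u::ab_group_add \<Rightarrow> 'u"
  assumes U: "vector_space scale"
    and closed: "\<And>c v. v \<in> carrier V \<Longrightarrow> c \<odot>\<^bsub>V\<^esub> v \<in> carrier V"
    and lin: "\<And>u v w. u \<in> carrier V \<Longrightarrow> v \<in> carrier V \<Longrightarrow> w \<in> carrier W
               \<Longrightarrow> \<beta> (u \<oplus>\<^bsub>V\<^esub> v) w = \<beta> u w + \<beta> v w"
      "\<And>v w z. v \<in> carrier V \<Longrightarrow> w \<in> carrier W \<Longrightarrow> z \<in> carrier W
               \<Longrightarrow> \<beta> v (w \<oplus>\<^bsub>W\<^esub> z) = \<beta> v w + \<beta> v z"
      "\<And>c v w. v \<in> carrier V \<Longrightarrow> w \<in> carrier W \<Longrightarrow> \<beta> (c \<odot>\<^bsub>V\<^esub> v) w = scale c (\<beta> v w)"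
      "\<And>c v w. v \<in> carrier V \<Longrightarrow> w \<in> carrier W \<Longrightarrow> \<beta> v (c \<odot>\<^bsub>W\<^esub> w) = scale c (\<beta> v w)"
  defines "T \<equiv> tensor_algebra V W"
  shows "\<exists>!L. L \<in> extensional (carrier T) \<and>
      (\<forall>s\<in>carrier T. \<forall>t\<in>carrier T. L (s \<oplus>\<^bsub>T\<^esub> t) = L s + L t) \<and>
      (\<forall>c. \<forall>t\<in>carrier T. L (c \<odot>\<^bsub>T\<^esub> t) = scale c (L t)) \<and>
      (\<forall>v\<in>carrier V. \<forall>w\<in>carrier W. L (tens V W v w) = \<beta> v w)"
proof -
  interpret U: vector_space scale by fact
  define S where "S = (\<lambda>(m::nat) v w B. \<Sum>i<m. tens V W (v i) (w i) B)"
  define ok where "ok = (\<lambda>(m::nat) v w. (\<forall>i<m. v i \<in> carrier V) \<and> (\<forall>i<m. w i \<in> carrier W))"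
  have carr: "carrier T = {S m v w | m v w. ok m v w}"
    unfolding T_def tensor_algebra_def S_def ok_def by simp
  define L where "L = (\<lambda>t\<in>carrier T. THE u. \<exists>m v w. ok m v w \<and> t = S m v w \<and> u = (\<Sum>i<m. \<beta> (v i) (w i)))"
  have wd: "(\<Sum>i<m. \<beta> (v i) (w i)) = (\<Sum>i<m'. \<beta> (v' i) (w' i))"
    if "S m v w = S m' v' w'" for m m' v v' w w'
    by (rule tens_sum_determines_bilinear[where scale = scale and V = V and W = W, OF U lin])
       (use that in \<open>simp_all add: S_def\<close>)
  have L: "L (S m v w) = (\<Sum>i<m. \<beta> (v i) (w i))" if "ok m v w" for m v w
  proof -
    have mem: "S m v w \<in> carrier T" using that carr by auto
    have "(THE u. \<exists>m' v' w'. ok m' v' w' \<and> S m v w = S m' v' w' \<and> u = (\<Sum>i<m'. \<beta> (v' i) (w' i)))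
        = (\<Sum>i<m. \<beta> (v i) (w i))"
    proof (rule the_equality)
      show "\<exists>m' v' w'. ok m' v' w' \<and> S m v w = S m' v' w' \<and>
          (\<Sum>i<m. \<beta> (v i) (w i)) = (\<Sum>i<m'. \<beta> (v' i) (w' i))"
        using that by blast
    next
      fix u assume "\<exists>m' v' w'. ok m' v' w' \<and> S m v w = S m' v' w' \<and> u = (\<Sum>i<m'. \<beta> (v' i) (w' i))"
      then obtain m' v' w' where "S m v w = S m' v' w'" "u = (\<Sum>i<m'. \<beta> (v' i) (w' i))" by auto
      then show "u = (\<Sum>i<m. \<beta> (v i) (w i))" using wd[of m v w m' v' w'] by simp
    qed
    with mem show ?thesis by (simp add: L_def)
  qed
  have pure: "tens V W v w = S 1 (\<lambda>_. v) (\<lambda>_. w)" for v w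
    by (simp add: S_def)
  have add: "\<exists>v'' w''. ok (m + m') v'' w'' \<and> S m v w \<oplus>\<^bsub>T\<^esub> S m' v' w' = S (m + m') v'' w'' \<and>
      (\<Sum>i<m + m'. \<beta> (v'' i) (w'' i)) = (\<Sum>i<m. \<beta> (v i) (w i)) + (\<Sum>i<m'. \<beta> (v' i) (w' i))"
    if o: "ok m v w" "ok m' v' w'" for m m' v v' w w'
  proof -
    define v'' where "v'' = (\<lambda>i. if i < m then v i else v' (i - m))"
    define w'' where "w'' = (\<lambda>i. if i < m then w i else w' (i - m))"
    have split: "(\<Sum>i<m + m'. f (v'' i) (w'' i)) = (\<Sum>i<m. f (v i) (w i)) + (\<Sum>i<m'. f (v' i) (w' i))"
      for f :: "'v \<Rightarrow> 'w \<Rightarrow> 'x::comm_monoid_add"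
    proof -
      have "(\<Sum>i<m + m'. f (v'' i) (w'' i))
          = (\<Sum>i<m. f (v'' i) (w'' i)) + (\<Sum>i=m..<m + m'. f (v'' i) (w'' i))"
        unfolding lessThan_atLeast0 by (simp add: sum.atLeastLessThan_concat)
      also have "(\<Sum>i=m..<m + m'. f (v'' i) (w'' i)) = (\<Sum>i<m'. f (v'' (i + m)) (w'' (i + m)))"
        using sum.shift_bounds_nat_ivl[of "\<lambda>i. f (v'' i) (w'' i)" 0 m m']
        by (simp add: lessThan_atLeast0 add.commute)
      finally show ?thesis by (simp add: v''_def w''_def)
    qed
    have "ok (m + m') v'' w''"
      using o by (auto simp: ok_def v''_def w''_def)
    moreover have "S m v w \<oplus>\<^bsub>T\<^esub> S m' v' w' = S (m + m') v'' w''"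
      unfolding T_def tensor_algebra_def S_def by (simp add: split[of "\<lambda>v w. tens V W v w _"])
    ultimately show ?thesis using split[of \<beta>] by blast
  qed
  have scale: "ok m (\<lambda>i. c \<odot>\<^bsub>V\<^esub> v i) w \<and> c \<odot>\<^bsub>T\<^esub> S m v w = S m (\<lambda>i. c \<odot>\<^bsub>V\<^esub> v i) w"
    if o: "ok m v w" for c m v w
  proof -
    have "c * tens V W (v i) (w i) B = tens V W (c \<odot>\<^bsub>V\<^esub> v i) (w i) B" if "i < m" for i B
      using o that by (auto simp: tens_def ok_def bilinear_form_def linear_form_def)
    then show ?thesis
      using o closed unfolding T_def tensor_algebra_def S_def
      by (auto simp: ok_def sum_distrib_left fun_eq_iff intro!: sum.cong)
  qed
  show ?thesis
  proof (rule ex1I[of _ L], intro conjI ballI allI)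
    show "L \<in> extensional (carrier T)" by (simp add: L_def)
    show "L (s \<oplus>\<^bsub>T\<^esub> t) = L s + L t" if "s \<in> carrier T" "t \<in> carrier T" for s t
    proof -
      obtain m v w m' v' w' where o: "ok m v w" "ok m' v' w'" "s = S m v w" "t = S m' v' w'"
        using \<open>s \<in> carrier T\<close> \<open>t \<in> carrier T\<close> carr by auto
      show ?thesis using add[OF o(1,2)] L o by auto
    qed
    show "L (c \<odot>\<^bsub>T\<^esub> t) = scale c (L t)" if "t \<in> carrier T" for c t
    proof -
      obtain m v w where o: "ok m v w" "t = S m v w" using \<open>t \<in> carrier T\<close> carr by auto
      have "(\<Sum>i<m. \<beta> (c \<odot>\<^bsub>V\<^esub> v i) (w i)) = scale c (\<Sum>i<m. \<beta> (v i) (w i))"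
        using o(1) by (auto simp: ok_def U.scale_sum_right lin intro!: sum.cong)
      then show ?thesis using scale[OF o(1), of c] L o by auto
    qed
    show "L (tens V W v w) = \<beta> v w" if "v \<in> carrier V" "w \<in> carrier W" for v w
      using L[of 1 "\<lambda>_. v" "\<lambda>_. w"] \<open>v \<in> carrier V\<close> \<open>w \<in> carrier W\<close> by (simp add: pure ok_def)
  next
    fix M assume M: "M \<in> extensional (carrier T) \<and>
      (\<forall>s\<in>carrier T. \<forall>t\<in>carrier T. M (s \<oplus>\<^bsub>T\<^esub> t) = M s + M t) \<and>
      (\<forall>c. \<forall>t\<in>carrier T. M (c \<odot>\<^bsub>T\<^esub> t) = scale c (M t)) \<and>
      (\<forall>v\<in>carrier V. \<forall>w\<in>carrier W. M (tens V W v w) = \<beta> v w)"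
    have "M (S m v w) = (\<Sum>i<m. \<beta> (v i) (w i))" if "ok m v w" for m v w
      using that
    proof (induction m)
      case 0
      have mem: "S 0 v w \<in> carrier T" using 0 carr by auto
      moreover have "S 0 v w \<oplus>\<^bsub>T\<^esub> S 0 v w = S 0 v w"
        unfolding T_def tensor_algebra_def S_def by simp
      ultimately have "M (S 0 v w) = M (S 0 v w) + M (S 0 v w)" using M by metis
      then show ?case by simp
    next
      case (Suc m)
      have o: "ok m v w" "v m \<in> carrier V" "w m \<in> carrier W" using Suc.prems by (auto simp: ok_def)
      have "ok 1 (\<lambda>_. v m) (\<lambda>_. w m)" using o by (simp add: ok_def)
      then have mem: "S m v w \<in> carrier T" "tens V W (v m) (w m) \<in> carrier T"
        unfolding pure carr using o(1) by blast+
      have "S (Suc m) v w = S m v w \<oplus>\<^bsub>T\<^esub> tens V W (v m) (w m)"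
        unfolding T_def tensor_algebra_def S_def by simp
      then show ?case using M mem o Suc.IH by simp
    qed
    then have "M t = L t" if "t \<in> carrier T" for t
      using that carr L by auto
    then show "M = L"
      using M by (intro extensionalityI[of _ "carrier T"]) (auto simp: L_def)
  qed
qed


section \<open>Hopf algebras, grouplike elements and duals\<close>

record ('k, 'v) hopf = "('k, 'v) module" +
  comult :: "'v \<Rightarrow> ('k, 'v, 'v) tensor"
  counit :: "'v \<Rightarrow> 'k"
  antipode :: "'v \<Rightarrow> 'v"

definition grouplikes :: "('k::field, 'v, 'm) hopf_scheme \<Rightarrow> 'v monoid" where
  "grouplikes H =
    \<lparr>carrier = {g \<in> carrier H. comult H g = tens H H g g \<and> counit H g = 1},
     mult = mult H, one = one H\<rparr>"

text \<open>
  The dual of a finite-dimensional Hopf algebra. Linear forms are normalised to be 0 outside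
  the carrier. The product is \<open>(f g) h = (f \<otimes> g) (\<Delta> h)\<close>.
\<close>

definition dual_algebra :: "('k::field, 'v, 'm) hopf_scheme \<Rightarrow> ('k, 'v \<Rightarrow> 'k) module" where
  "dual_algebra H =
    \<lparr>carrier = {f. linear_form H f \<and> (\<forall>h. h \<notin> carrier H \<longrightarrow> f h = 0)},
     mult = (\<lambda>f g h. if h \<in> carrier H then comult H h (\<lambda>u v. f u * g v) else 0),
     one = (\<lambda>h. if h \<in> carrier H then counit H h else 0),
     zero = (\<lambda>h. 0),
     add = (\<lambda>f g h. f h + g h),
     smult = (\<lambda>c f h. c * f h)\<rparr>"

text \<open>
  The comultiplication of the dual is the transpose of the multiplication of \<open>H\<close>: it sends \<open>f\<close> to
  the unique tensor whose image in \<open>(H \<otimes> H)\<^sup>*\<close> is \<open>h \<otimes> h' \<mapsto> f (h h')\<close>. Uniqueness always holds;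
  existence is where finite dimension is needed.
\<close>

definition dual_hopf :: "('k::field, 'v, 'm) hopf_scheme \<Rightarrow> ('k, 'v \<Rightarrow> 'k) hopf" where
  "dual_hopf H = module.extend (dual_algebra H)
    \<lparr>comult = (\<lambda>f. THE t. t \<in> carrier (tensor_algebra (dual_algebra H) (dual_algebra H)) \<and>
        (\<forall>h\<in>carrier H. \<forall>h'\<in>carrier H. t (\<lambda>\<phi> \<psi>. \<phi> h * \<psi> h') = f (h \<otimes>\<^bsub>H\<^esub> h'))),
     counit = (\<lambda>f. f \<one>\<^bsub>H\<^esub>),
     antipode = (\<lambda>f h. if h \<in> carrier H then f (antipode H h) else 0)\<rparr>"


section \<open>The free algebra on two generators\<close>

datatype gen = GenA | GenX

text \<open>Words form a monoid under concatenation, written additively because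
  \<open>poly_mapping\<close> takes its convolution product with respect to addition of exponents.\<close>

datatype word = Word (letters: "gen list")

instantiation word :: monoid_add
begin
definition zero_word :: word where "0 = Word []"
definition plus_word :: "word \<Rightarrow> word \<Rightarrow> word" where "u + v = Word (letters u @ letters v)"
instance by standard (simp_all add: zero_word_def plus_word_def)
end

type_synonym 'k free_alg = "word \<Rightarrow>\<^sub>0 'k"

definition scalar :: "'k::field \<Rightarrow> 'k free_alg" where
  "scalar c = Poly_Mapping.single 0 c"

definition generator :: "gen \<Rightarrow> 'k::field free_alg" where
  "generator g = Poly_Mapping.single (Word [g]) 1"

definition free_algebra :: "('k::field, 'k free_alg) module" where
  "free_algebra = type_algebra (\<lambda>c p. scalar c * p)"

text \<open>The unique algebra homomorphism from the free algebra to \<open>M\<close> that sends each generator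
  \<open>g\<close> to \<open>\<gamma> g\<close>.\<close>

definition free_lift :: "('k::field, 'v, 'm) module_scheme \<Rightarrow> (gen \<Rightarrow> 'v) \<Rightarrow> 'k free_alg \<Rightarrow> 'v" where
  "free_lift M \<gamma> p =
    (\<Oplus>\<^bsub>M\<^esub>w\<in>Poly_Mapping.keys p.
       Poly_Mapping.lookup p w \<odot>\<^bsub>M\<^esub> foldr (\<lambda>g u. \<gamma> g \<otimes>\<^bsub>M\<^esub> u) (letters w) \<one>\<^bsub>M\<^esub>)"


section \<open>The Hopf algebras $H_{n,q,N,\nu,\alpha}$\<close>

definition H_relations ::
    "nat \<Rightarrow> 'k::field \<Rightarrow> nat \<Rightarrow> nat \<Rightarrow> 'k \<Rightarrow> 'k free_alg set" where
  "H_relations n q N \<nu> \<alpha> =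
    (let a = generator GenA; x = generator GenX in
      {a ^ N - 1,
       x * a - scalar q * a * x,
       (if \<alpha> = 0 then x ^ mult_order (q ^ \<nu>)
        else x ^ n - scalar \<alpha> * (a ^ (\<nu> * n) - 1))})"

definition H_ideal ::
    "nat \<Rightarrow> 'k::field \<Rightarrow> nat \<Rightarrow> nat \<Rightarrow> 'k \<Rightarrow> 'k free_alg set" where
  "H_ideal n q N \<nu> \<alpha> = Idl\<^bsub>free_algebra\<^esub> (H_relations n q N \<nu> \<alpha>)"

definition H_algebra ::
    "nat \<Rightarrow> 'k::field \<Rightarrow> nat \<Rightarrow> nat \<Rightarrow> 'k \<Rightarrow> ('k, 'k free_alg set) module" where
  "H_algebra n q N \<nu> \<alpha> = quotient_algebra free_algebra (H_ideal n q N \<nu> \<alpha>)"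

definition H_gen ::
    "nat \<Rightarrow> 'k::field \<Rightarrow> nat \<Rightarrow> nat \<Rightarrow> 'k \<Rightarrow> gen \<Rightarrow> 'k free_alg set" where
  "H_gen n q N \<nu> \<alpha> g = H_ideal n q N \<nu> \<alpha> +>\<^bsub>free_algebra\<^esub> generator g"

text \<open>
  \<open>\<Delta>\<close> and \<open>\<epsilon>\<close> are the algebra homomorphisms, and \<open>s\<close> the algebra antihomomorphism, with the
  prescribed values on the generators; each is induced on cosets by the corresponding map
  on the free algebra, which is constant on every coset.
\<close>

definition H_hopf ::
    "nat \<Rightarrow> 'k::field \<Rightarrow> nat \<Rightarrow> nat \<Rightarrow> 'k \<Rightarrow> ('k, 'k free_alg set) hopf" where
  "H_hopf n q N \<nu> \<alpha> =
    (let H = H_algebra n q N \<nu> \<alpha>;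
         a = H_gen n q N \<nu> \<alpha> GenA;
         x = H_gen n q N \<nu> \<alpha> GenX;
         HH = tensor_algebra H H;
         \<Delta> = free_lift HH (\<lambda>g. case g of
               GenA \<Rightarrow> tens H H a a
             | GenX \<Rightarrow> tens H H x (a [^]\<^bsub>H\<^esub> \<nu>) \<oplus>\<^bsub>HH\<^esub> tens H H \<one>\<^bsub>H\<^esub> x);
         \<epsilon> = free_lift (type_algebra (*)) (\<lambda>g. case g of GenA \<Rightarrow> 1 | GenX \<Rightarrow> 0);
         s = free_lift (opposite_algebra H) (\<lambda>g. case g of
               GenA \<Rightarrow> inv\<^bsub>H\<^esub> a
             | GenX \<Rightarrow> (- inverse (q ^ \<nu>)) \<odot>\<^bsub>H\<^esub> (((inv\<^bsub>H\<^esub> a) [^]\<^bsub>H\<^esub> \<nu>) \<otimes>\<^bsub>H\<^esub> x))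
     in module.extend H
      \<lparr>comult = (\<lambda>C. the_elem (\<Delta> ` C)),
       counit = (\<lambda>C. the_elem (\<epsilon> ` C)),
       antipode = (\<lambda>C. the_elem (s ` C))\<rparr>)"

end

(* Polynomial precedes Defs so that the unqualified name order denotes the order of a group, not
   the multiplicity of a root. *)
theory Submission
  imports "HOL-Computational_Algebra.Polynomial" Defs
begin

text \<open>
  The monomials \<open>a\<^sup>i x\<^sup>j\<close> with bounded exponents span the algebra \<open>H\<close>, so \<open>H\<close> is
  finite-dimensional and has dual bases. These identify tensors over the dual with bilinear forms on
  \<open>H\<close>, so the grouplike elements of the dual are exactly the characters of the algebra \<open>H\<close>. A
  character is given by scalars \<open>u, v\<close> (the images of \<open>a, x\<close>) that satisfy the defining relations.
  The relation \<open>xa = qax\<close> with \<open>q \<noteq> 1\<close>, or \<open>x\<^sup>r = 0\<close> if \<open>\<alpha> = 0\<close>, forces \<open>v = 0\<close>; what remains is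
  \<open>u\<^sup>N = 1\<close>, together with \<open>u\<^bsup>\<nu>n\<^esup> = 1\<close> if \<open>\<alpha> \<noteq> 0\<close>.
\<close>

section \<open>Grouplike elements of a finite-dimensional dual\<close>

lemma carrier_dual_algebra:
  "f \<in> carrier (dual_algebra H) \<longleftrightarrow> linear_form H f \<and> (\<forall>h. h \<notin> carrier H \<longrightarrow> f h = 0)"
  by (simp add: dual_algebra_def)

lemma add_dual_algebra: "f \<oplus>\<^bsub>dual_algebra H\<^esub> g = (\<lambda>h. f h + g h)"
  by (simp add: dual_algebra_def)

lemma smult_dual_algebra: "c \<odot>\<^bsub>dual_algebra H\<^esub> f = (\<lambda>h. c * f h)"
  by (simp add: dual_algebra_def)

text \<open>Value and membership are proved together: additivity of \<open>F\<close> applies in the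
  induction step only once the partial sum is known to lie in the dual.\<close>

lemma linear_form_dual_sum:
  assumes F: "linear_form (dual_algebra H) F" and "finite A"
    and d: "\<And>a. a \<in> A \<Longrightarrow> d a \<in> carrier (dual_algebra H)"
  shows "F (\<lambda>h. \<Sum>a\<in>A. c a * d a h) = (\<Sum>a\<in>A. c a * F (d a)) \<and>
    (\<lambda>h. \<Sum>a\<in>A. c a * d a h) \<in> carrier (dual_algebra H)"
  using \<open>finite A\<close> d
proof (induction A)
  case empty
  have z: "(\<lambda>h. 0) \<in> carrier (dual_algebra H)"
    by (simp add: carrier_dual_algebra linear_form_def)
  \<comment> \<open>\<open>linear_form\<close> has no clause for zero, so the value at the zero form
    comes from homogeneity with \<open>c = 0\<close>.\<close>
  have "F (c \<odot>\<^bsub>dual_algebra H\<^esub> (\<lambda>h. 0)) = c * F (\<lambda>h. 0)" for c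
    using F z by (simp only: linear_form_def[of "dual_algebra H"])
  from this[of 0] have "F (\<lambda>h. 0) = 0" by (simp add: smult_dual_algebra)
  with z show ?case by simp
next
  case (insert a A)
  let ?g = "\<lambda>h. \<Sum>a\<in>A. c a * d a h"
  have g: "?g \<in> carrier (dual_algebra H)" and a: "d a \<in> carrier (dual_algebra H)"
    and IH: "F ?g = (\<Sum>a\<in>A. c a * F (d a))"
    using insert by auto
  have ca: "(\<lambda>h. c a * d a h) \<in> carrier (dual_algebra H)"
    using a by (auto simp: carrier_dual_algebra linear_form_def algebra_simps)
  have "(\<lambda>h. c a * d a h + ?g h) \<in> carrier (dual_algebra H)"
    using ca g unfolding carrier_dual_algebra linear_form_def
    by (simp add: algebra_simps)
  moreover have "F (\<lambda>h. c a * d a h + ?g h) = F (\<lambda>h. c a * d a h) + F ?g"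
    using F ca g by (simp add: linear_form_def[of "dual_algebra H"] add_dual_algebra)
  moreover have "F (\<lambda>h. c a * d a h) = c a * F (d a)"
    using F a by (simp add: linear_form_def[of "dual_algebra H"] smult_dual_algebra)
  ultimately show ?case using insert.hyps IH by simp
qed

text \<open>The carrier of \<open>tensor_algebra\<close> consists of sums over initial segments of
  the naturals; an enumeration of \<open>A\<close> brings a sum over a finite set to that
  form.\<close>

lemma tens_sum_in_carrier:
  assumes "finite A" and "\<And>a. a \<in> A \<Longrightarrow> v a \<in> carrier V" and "\<And>a. a \<in> A \<Longrightarrow> w a \<in> carrier W"
  shows "(\<lambda>B. \<Sum>a\<in>A. tens V W (v a) (w a) B) \<in> carrier (tensor_algebra V W)"
proof -
  obtain b where b: "bij_betw b {..<card A} A"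
    using ex_bij_betw_nat_finite[OF \<open>finite A\<close>] by (auto simp: lessThan_atLeast0)
  have "(\<lambda>B. \<Sum>a\<in>A. tens V W (v a) (w a) B)
      = (\<lambda>B. \<Sum>i<card A. tens V W (v (b i)) (w (b i)) B)"
    by (simp add: sum.reindex_bij_betw[OF b, of "\<lambda>a. tens V W (v a) (w a) _"])
  moreover have "\<forall>i<card A. v (b i) \<in> carrier V \<and> w (b i) \<in> carrier W"
    using assms bij_betwE[OF b] by auto
  ultimately show ?thesis
    unfolding tensor_algebra_def
    by (simp only: module.simps partial_object.simps mem_Collect_eq)
      (intro exI[of _ "card A"] exI[of _ "\<lambda>i. v (b i)"] exI[of _ "\<lambda>i. w (b i)"], simp)
qed

text \<open>Since \<open>tens\<close> is 0 on arguments that are not bilinear, this is what allows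
  tensors over the dual to be evaluated at a pair of points.\<close>

lemma bilinear_form_eval:
  "bilinear_form (dual_algebra H) (dual_algebra H) (\<lambda>\<phi> \<psi>. \<phi> h * \<psi> h')"
  unfolding bilinear_form_def linear_form_def
  by (simp add: dual_algebra_def algebra_simps)

text \<open>The hypotheses say that \<open>(e, d e)\<close> for \<open>e \<in> E\<close> is a pair of dual bases of \<open>H\<close> and its dual; the
  expansion is stated on linear forms so that no sums in \<open>H\<close> occur.\<close>

locale dual_bases =
  fixes H :: "('k::field, 'v, 'm) hopf_scheme" and E :: "'v set" and d :: "'v \<Rightarrow> 'v \<Rightarrow> 'k"
  assumes finite_E: "finite E" and E_carrier: "E \<subseteq> carrier H"
    and d_carrier: "e \<in> E \<Longrightarrow> d e \<in> carrier (dual_algebra H)"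
    and expand: "linear_form H f \<Longrightarrow> h \<in> carrier H \<Longrightarrow> f h = (\<Sum>e\<in>E. f e * d e h)"
    and mult_bilinear: "linear_form H f \<Longrightarrow> bilinear_form H H (\<lambda>h h'. f (h \<otimes>\<^bsub>H\<^esub> h'))"
begin

abbreviation "D \<equiv> dual_algebra H"

lemma dual_expand:
  assumes "\<phi> \<in> carrier D"
  shows "\<phi> = (\<lambda>h. \<Sum>e\<in>E. \<phi> e * d e h)"
proof
  fix h
  show "\<phi> h = (\<Sum>e\<in>E. \<phi> e * d e h)"
  proof (cases "h \<in> carrier H")
    case True
    then show ?thesis using assms expand by (simp add: carrier_dual_algebra)
  next
    case False
    then have "d e h = 0" if "e \<in> E" for e
      using that d_carrier by (auto simp: carrier_dual_algebra)
    then show ?thesis using assms False by (simp add: carrier_dual_algebra)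
  qed
qed

lemma bilinear_expand:
  assumes B: "bilinear_form D D B" and "\<phi> \<in> carrier D" "\<psi> \<in> carrier D"
  shows "B \<phi> \<psi> = (\<Sum>e\<in>E. \<Sum>e'\<in>E. \<phi> e * \<psi> e' * B (d e) (d e'))"
proof -
  have 1: "B \<chi> \<psi> = (\<Sum>e'\<in>E. \<psi> e' * B \<chi> (d e'))" if "\<chi> \<in> carrier D" for \<chi>
  proof -
    have "linear_form D (B \<chi>)" using B that by (simp add: bilinear_form_def)
    from linear_form_dual_sum[OF this finite_E, where d = d and c = \<psi>, OF d_carrier]
    show ?thesis using dual_expand[OF \<open>\<psi> \<in> carrier D\<close>] by simp
  qed
  have "linear_form D (\<lambda>v. B v \<psi>)" using B \<open>\<psi> \<in> carrier D\<close> by (simp add: bilinear_form_def)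
  from linear_form_dual_sum[OF this finite_E, where d = d and c = \<phi>, OF d_carrier]
  have "B \<phi> \<psi> = (\<Sum>e\<in>E. \<phi> e * B (d e) \<psi>)"
    using dual_expand[OF \<open>\<phi> \<in> carrier D\<close>] by simp
  then show ?thesis
    by (simp add: 1 d_carrier sum_distrib_left mult.assoc)
qed

text \<open>Expand both factors of each elementary tensor in the dual basis; the resulting
  coefficient at \<open>e, e'\<close> is the value of \<open>t\<close> at the evaluation form of
  that pair.\<close>

lemma tensor_expand:
  assumes "t \<in> carrier (tensor_algebra D D)"
  shows "t B = (if bilinear_form D D B
    then \<Sum>e\<in>E. \<Sum>e'\<in>E. t (\<lambda>\<phi> \<psi>. \<phi> e * \<psi> e') * B (d e) (d e') else 0)"
proof -
  obtain m :: nat and v w where t: "t = (\<lambda>B. \<Sum>i<m. tens D D (v i) (w i) B)"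
    and vw: "\<forall>i<m. v i \<in> carrier D" "\<forall>i<m. w i \<in> carrier D"
    using assms unfolding tensor_algebra_def by auto
  show ?thesis
  proof (cases "bilinear_form D D B")
    case True
    have "t B = (\<Sum>i<m. \<Sum>e\<in>E. \<Sum>e'\<in>E. v i e * w i e' * B (d e) (d e'))"
      unfolding t using True vw by (simp add: tens_def bilinear_expand[OF True])
    also have "\<dots> = (\<Sum>e\<in>E. \<Sum>e'\<in>E. \<Sum>i<m. v i e * w i e' * B (d e) (d e'))"
      by (subst sum.swap) (rule sum.cong[OF refl], rule sum.swap)
    also have "\<dots> = (\<Sum>e\<in>E. \<Sum>e'\<in>E. t (\<lambda>\<phi> \<psi>. \<phi> e * \<psi> e') * B (d e) (d e'))"
      unfolding t by (simp add: tens_def bilinear_form_eval sum_distrib_right)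
    finally show ?thesis using True by simp
  next
    case False
    then show ?thesis by (simp add: t tens_def)
  qed
qed

text \<open>Injectivity of the map from the tensor square of the dual to the forms on pairs of
  elements of \<open>H\<close>. It gives the uniqueness in the definition of
  \<open>dual_hopf\<close>.\<close>

lemma tensor_eqI:
  assumes "s \<in> carrier (tensor_algebra D D)" "t \<in> carrier (tensor_algebra D D)"
    and "\<And>h h'. h \<in> carrier H \<Longrightarrow> h' \<in> carrier H
      \<Longrightarrow> s (\<lambda>\<phi> \<psi>. \<phi> h * \<psi> h') = t (\<lambda>\<phi> \<psi>. \<phi> h * \<psi> h')"
  shows "s = t"
proof
  fix B
  have "s (\<lambda>\<phi> \<psi>. \<phi> e * \<psi> e') = t (\<lambda>\<phi> \<psi>. \<phi> e * \<psi> e')" if "e \<in> E" "e' \<in> E" for e e'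
    using assms(3) that E_carrier by blast
  then show "s B = t B"
    by (simp add: tensor_expand[OF assms(1), of B] tensor_expand[OF assms(2), of B])
qed

lemma mult_expand:
  assumes f: "linear_form H f" and h: "h \<in> carrier H" "h' \<in> carrier H"
  shows "f (h \<otimes>\<^bsub>H\<^esub> h') = (\<Sum>e\<in>E. \<Sum>e'\<in>E. f (e \<otimes>\<^bsub>H\<^esub> e') * d e h * d e' h')"
proof -
  have b: "bilinear_form H H (\<lambda>h h'. f (h \<otimes>\<^bsub>H\<^esub> h'))" by (rule mult_bilinear[OF f])
  have "f (h \<otimes>\<^bsub>H\<^esub> h') = (\<Sum>e\<in>E. f (e \<otimes>\<^bsub>H\<^esub> h') * d e h)"
    by (rule expand[of "\<lambda>h. f (h \<otimes>\<^bsub>H\<^esub> h')"]) (use b h in \<open>auto simp: bilinear_form_def\<close>)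
  also have "\<dots> = (\<Sum>e\<in>E. (\<Sum>e'\<in>E. f (e \<otimes>\<^bsub>H\<^esub> e') * d e' h') * d e h)"
  proof (intro sum.cong refl arg_cong2[where f = "(*)"])
    fix e assume "e \<in> E"
    then show "f (e \<otimes>\<^bsub>H\<^esub> h') = (\<Sum>e'\<in>E. f (e \<otimes>\<^bsub>H\<^esub> e') * d e' h')"
      using b h E_carrier by (intro expand) (auto simp: bilinear_form_def)
  qed
  finally show ?thesis by (simp add: sum_distrib_left sum_distrib_right mult_ac)
qed

text \<open>Unfolds the definite description in \<open>dual_hopf\<close>: dual bases provide
  existence, \<open>tensor_eqI\<close> uniqueness.\<close>

lemma comult_dual_eq_iff:
  assumes f: "f \<in> carrier D"
  shows "comult (dual_hopf H) f = t \<longleftrightarrow> t \<in> carrier (tensor_algebra D D) \<and>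
    (\<forall>h\<in>carrier H. \<forall>h'\<in>carrier H. t (\<lambda>\<phi> \<psi>. \<phi> h * \<psi> h') = f (h \<otimes>\<^bsub>H\<^esub> h'))"
    (is "_ \<longleftrightarrow> ?P t")
proof -
  \<comment> \<open>The coefficients are the values of \<open>f\<close> at products of basis
    elements, as in \<open>mult_expand\<close>. They are absorbed in the first factor because the
    carrier consists of sums without scalars.\<close>
  define t0 where "t0 = (\<lambda>B. \<Sum>(e, e')\<in>E \<times> E. tens D D (\<lambda>h. f (e \<otimes>\<^bsub>H\<^esub> e') * d e h) (d e') B)"
  have "(\<lambda>h. c * d e h) \<in> carrier D" if "e \<in> E" for c e
    using d_carrier[OF that] by (auto simp: carrier_dual_algebra linear_form_def algebra_simps)
  then have "t0 \<in> carrier (tensor_algebra D D)"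
    unfolding t0_def case_prod_unfold
    by (intro tens_sum_in_carrier) (auto simp: finite_E d_carrier)
  moreover have "t0 (\<lambda>\<phi> \<psi>. \<phi> h * \<psi> h') = f (h \<otimes>\<^bsub>H\<^esub> h')"
    if "h \<in> carrier H" "h' \<in> carrier H" for h h'
    using mult_expand[of f h h'] f that
    by (simp add: t0_def tens_def bilinear_form_eval carrier_dual_algebra sum.cartesian_product)
  ultimately have ex1: "\<exists>!t. ?P t"
    by (intro ex1I[of _ t0]) (auto intro!: tensor_eqI)
  have "comult (dual_hopf H) f = (THE t. ?P t)"
    by (simp add: dual_hopf_def dual_algebra_def module.defs)
  then show ?thesis
    using theI'[OF ex1] the1_equality[OF ex1, of t] by auto
qed

text \<open>\<open>tens\<close> sees its arguments only through carrier, addition and scalar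
  multiplication, where \<open>dual_hopf H\<close> and \<open>D\<close> agree.\<close>

lemma tens_dual_hopf: "tens (dual_hopf H) (dual_hopf H) = tens D D"
  by (intro ext) (simp add: tens_def bilinear_form_def linear_form_def dual_hopf_def
      dual_algebra_def module.defs)

text \<open>The tensor of \<open>f\<close> with itself takes the value \<open>f h * f h'\<close> at
  the evaluation form of \<open>h, h'\<close>, so the grouplike condition becomes multiplicativity;
  the counit condition is \<open>f\<close> at the unit.\<close>

lemma carrier_grouplikes_dual:
  "carrier (grouplikes (dual_hopf H)) = {f \<in> carrier D. f \<one>\<^bsub>H\<^esub> = 1 \<and>
    (\<forall>h\<in>carrier H. \<forall>h'\<in>carrier H. f (h \<otimes>\<^bsub>H\<^esub> h') = f h * f h')}"
proof -
  have "comult (dual_hopf H) f = tens D D f f \<longleftrightarrow>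
      (\<forall>h\<in>carrier H. \<forall>h'\<in>carrier H. f (h \<otimes>\<^bsub>H\<^esub> h') = f h * f h')" if "f \<in> carrier D" for f
    unfolding comult_dual_eq_iff[OF that]
    using tens_sum_in_carrier[of "{()}" "\<lambda>_. f" D "\<lambda>_. f" D] that
    by (auto simp: tens_def bilinear_form_eval)
  moreover have "carrier (dual_hopf H) = carrier D" "counit (dual_hopf H) = (\<lambda>f. f \<one>\<^bsub>H\<^esub>)"
    by (simp_all add: dual_hopf_def dual_algebra_def module.defs)
  ultimately show ?thesis
    by (auto simp: grouplikes_def tens_dual_hopf)
qed

end

section \<open>Quotients of algebras\<close>

lemma type_algebra_simps [simp]:
  "carrier (type_algebra scale) = UNIV" "mult (type_algebra scale) = (*)"
  "one (type_algebra scale) = 1" "zero (type_algebra scale) = 0"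
  "add (type_algebra scale) = (+)" "smult (type_algebra scale) = scale"
  by (simp_all add: type_algebra_def)

lemma ring_type_algebra: "ring (type_algebra scale)"
proof (intro ringI abelian_groupI monoidI)
  show "\<exists>y\<in>carrier (type_algebra scale). y \<oplus>\<^bsub>type_algebra scale\<^esub> x = \<zero>\<^bsub>type_algebra scale\<^esub>"
    for x by (auto intro: exI[of _ "- x"])
qed (simp_all add: algebra_simps)

lemma a_r_coset_type_algebra: "I +>\<^bsub>type_algebra scale\<^esub> p = (\<lambda>i. i + p) ` I"
  by (auto simp: a_r_coset_def')

text \<open>The algebra is a whole type, so bases and spans are formed there; the quotient is a
  record whose elements are cosets.\<close>

locale algebra_quotient = vector_space scale
  for scale :: "'k::field \<Rightarrow> 'v::ring_1 \<Rightarrow> 'v" (infixr "*s" 75) +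
  fixes I :: "'v set"
  assumes mult_scale_left: "(c *s u) * v = c *s (u * v)"
    and mult_scale_right: "u * (c *s v) = c *s (u * v)"
    and ideal: "ideal I (type_algebra scale)"
begin

sublocale I: ideal I "type_algebra scale" by (rule ideal)

lemma ideal_add: "u \<in> I \<Longrightarrow> v \<in> I \<Longrightarrow> u + v \<in> I"
  using additive_subgroup.a_closed[OF I.additive_subgroup_axioms] by simp

lemma ideal_mult_left: "u \<in> I \<Longrightarrow> v * u \<in> I"
  using I.I_l_closed by simp

lemma ideal_mult_right: "u \<in> I \<Longrightarrow> u * v \<in> I"
  using I.I_r_closed by simp

text \<open>Scaling by \<open>c\<close> is left multiplication by \<open>c *s 1\<close>, so a ring
  ideal is also a subspace.\<close>

lemma ideal_scale: "u \<in> I \<Longrightarrow> c *s u \<in> I"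
  using ideal_mult_left[of u "c *s 1"] by (simp add: mult_scale_left)

lemma subspace_ideal: "subspace I"
  using additive_subgroup.zero_closed[OF I.additive_subgroup_axioms]
  by (simp add: subspace_def ideal_add ideal_scale)

lemmas ideal_diff = subspace_diff[OF subspace_ideal]

abbreviation Q where "Q \<equiv> quotient_algebra (type_algebra scale) I"

abbreviation coset where "coset p \<equiv> I +>\<^bsub>type_algebra scale\<^esub> p"

lemma mem_coset: "p' \<in> coset p \<longleftrightarrow> p' - p \<in> I"
  by (force simp: a_r_coset_type_algebra image_iff)

lemma coset_eq_iff: "coset p = coset p' \<longleftrightarrow> p - p' \<in> I"
proof
  assume "coset p = coset p'"
  then have "p \<in> coset p'" using subspace_0[OF subspace_ideal] by (auto simp: mem_coset)
  then show "p - p' \<in> I" by (simp add: mem_coset)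
next
  assume *: "p - p' \<in> I"
  have "u - p \<in> I \<longleftrightarrow> u - p' \<in> I" for u
    using ideal_add[OF _ *, of "u - p"] ideal_diff[OF _ *, of "u - p'"] by auto
  then show "coset p = coset p'" by (auto simp: mem_coset)
qed

lemma carrier_Q: "carrier Q = range coset"
  by (auto simp: quotient_algebra_def FactRing_def A_RCOSETS_def')

lemma mult_Q: "coset u \<otimes>\<^bsub>Q\<^esub> coset v = coset (u * v)"
  using I.rcoset_mult_add[of u v] by (simp add: quotient_algebra_def FactRing_def)

lemma one_Q: "\<one>\<^bsub>Q\<^esub> = coset 1"
  by (simp add: quotient_algebra_def FactRing_def)

lemma add_Q: "coset u \<oplus>\<^bsub>Q\<^esub> coset v = coset (u + v)"
  using I.a_rcos_sum[of u v] by (simp add: quotient_algebra_def FactRing_def)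

text \<open>The defining union runs over all representatives of a nonempty coset, and each of them
  contributes the same coset.\<close>

lemma smult_Q: "c \<odot>\<^bsub>Q\<^esub> coset u = coset (c *s u)"
proof -
  have "coset (c *s v) = coset (c *s u)" if "v \<in> coset u" for v
    using ideal_scale[of "v - u" c] that by (simp add: coset_eq_iff mem_coset scale_right_diff_distrib)
  then have "(\<Union>v\<in>coset u. coset (c *s v)) = (\<Union>v\<in>coset u. coset (c *s u))"
    by (rule SUP_cong[OF refl])
  moreover have "coset u \<noteq> {}" using subspace_0[OF subspace_ideal] mem_coset[of u u] by auto
  ultimately show ?thesis by (simp add: quotient_algebra_def)
qed

lemma linear_form_Q_iff:
  "linear_form Q f \<longleftrightarrow> Vector_Spaces.linear (*s) (*) (\<lambda>p. f (coset p))"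
proof -
  have "vector_space ((*) :: 'k \<Rightarrow> 'k \<Rightarrow> 'k)" by unfold_locales (simp_all add: algebra_simps)
  then show ?thesis
    using vector_space_axioms
    by (simp add: linear_form_def carrier_Q add_Q smult_Q Vector_Spaces.linear_iff)
qed

lemma module_extend_simps:
  "carrier (module.extend M X) = carrier M" "mult (module.extend M X) = mult M"
  "one (module.extend M X) = one M" "linear_form (module.extend M X) = linear_form M"
  by (simp_all add: module.defs linear_form_def fun_eq_iff)

lemma mult_bilinear_Q:
  assumes "linear_form Q f"
  shows "bilinear_form Q Q (\<lambda>h h'. f (h \<otimes>\<^bsub>Q\<^esub> h'))"
  using assms
  by (simp add: bilinear_form_def linear_form_def carrier_Q mult_Q add_Q smult_Q distrib_left
      distrib_right mult_scale_left mult_scale_right)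

text \<open>The dual basis is dual to the part outside \<open>I\<close> of a basis that contains a basis of \<open>I\<close>.\<close>

lemma ex_dual_bases_Q:
  assumes "finite S" and "span (S \<union> I) = UNIV"
  obtains E d where "dual_bases (module.extend Q X) E d"
proof -
  obtain C where C: "C \<subseteq> I" "independent C" "I \<subseteq> span C"
    using maximal_independent_subset .
  obtain B where B: "C \<subseteq> B" "B \<subseteq> S \<union> I" "independent B" "S \<union> I \<subseteq> span B"
    using maximal_independent_subset_extend[of C "S \<union> I"] C by auto
  have spanB: "span B = UNIV"
    using span_minimal[OF B(4) subspace_span] assms(2) by auto
  \<comment> \<open>An element of \<open>B - C\<close> inside \<open>I\<close> would lie in the span
    of \<open>C\<close>, against independence of \<open>B\<close>. This makes \<open>B - C\<close>
    finite.\<close>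
  have BC: "B - C \<subseteq> S"
  proof (rule ccontr)
    assume "\<not> B - C \<subseteq> S"
    then obtain b where b: "b \<in> B" "b \<notin> C" "b \<in> I" using B(2) by auto
    then have "b \<in> span (B - {b})" using C(3) span_mono[of C "B - {b}"] B(1) by blast
    then show False using B(3) b(1) by (auto simp: dependent_def)
  qed
  then have fin: "finite (B - C)" using \<open>finite S\<close> finite_subset by blast
  \<comment> \<open>Coordinate functions with respect to \<open>B\<close>. Those at \<open>b\<close>
    in \<open>B - C\<close> vanish on \<open>I\<close>, so they descend to the quotient.\<close>
  define g where "g = (\<lambda>b p. representation B p b)"
  have lin: "Vector_Spaces.linear (*s) (*) (g b)" for b
    unfolding g_def by (rule linear_representation[OF B(3) spanB])
  have g_ideal: "g b p = 0" if "b \<in> B - C" "p \<in> I" for b p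
  proof -
    have "representation B p b = representation C p b"
      using representation_extend[OF B(3), of p C] that C(3) B(1) by auto
    then show ?thesis using representation_ne_zero[of C p b] that by (auto simp: g_def)
  qed
  have g_eq: "g b p = g b p'" if "b \<in> B - C" "p - p' \<in> I" for b p p'
  proof -
    have "representation B (p - p') b = representation B p b - representation B p' b"
      using representation_diff[OF B(3), of p' p] spanB by auto
    then show ?thesis using g_ideal[OF that] by (simp add: g_def)
  qed
  have expand: "p - (\<Sum>b\<in>B - C. g b p *s b) \<in> I" for p
  proof -
    let ?K = "{b. representation B p b \<noteq> 0}"
    have K: "finite ?K" "?K \<subseteq> B"
      using finite_representation representation_ne_zero by auto
    have "p = (\<Sum>b\<in>?K. g b p *s b)"
      using sum_nonzero_representation_eq[OF B(3), of p] spanB by (simp add: g_def)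
    \<comment> \<open>\<open>B\<close> may be infinite, so the finite support \<open>?K\<close> is
      enlarged only by the finite set \<open>B - C\<close>; the terms from \<open>C\<close> then sum
      to an element of \<open>I\<close>.\<close>
    also have "\<dots> = (\<Sum>b\<in>(B - C) \<union> (?K \<inter> C). g b p *s b)"
      using K fin by (intro sum.mono_neutral_left) (auto simp: g_def)
    also have "\<dots> = (\<Sum>b\<in>B - C. g b p *s b) + (\<Sum>b\<in>?K \<inter> C. g b p *s b)"
      using K fin by (intro sum.union_disjoint) auto
    finally have "p - (\<Sum>b\<in>B - C. g b p *s b) = (\<Sum>b\<in>?K \<inter> C. g b p *s b)"
      by (simp add: algebra_simps)
    moreover have "(\<Sum>b\<in>?K \<inter> C. g b p *s b) \<in> I"
      using C(1) by (intro subspace_sum[OF subspace_ideal]) (auto intro: ideal_scale)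
    ultimately show ?thesis by simp
  qed
  have g_B: "g b b' = (if b' = b then 1 else 0)" if "b' \<in> B" for b b'
    using representation_basis[OF B(3) that] by (simp add: g_def)
  have inj: "inj_on coset (B - C)"
  proof (rule inj_onI)
    fix b b' assume "b \<in> B - C" "b' \<in> B - C" "coset b = coset b'"
    then have "g b b = g b b'" by (intro g_eq) (auto simp: coset_eq_iff)
    then show "b = b'" using g_B[of b b] g_B[of b' b] \<open>b \<in> B - C\<close> \<open>b' \<in> B - C\<close>
      by (auto split: if_splits)
  qed
  \<comment> \<open>The coordinate function induced on cosets: \<open>e\<close> determines its
    representative in \<open>B - C\<close> by injectivity, and by \<open>g_eq\<close> the choice for
    \<open>h\<close> does not matter. The value 0 off the carrier is the normalisation in
    \<open>dual_algebra\<close>.\<close>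
  define d where "d = (\<lambda>e h. if h \<in> carrier Q
    then g (the_inv_into (B - C) coset e) (SOME p. h = coset p) else 0)"
  have d: "d (coset b) (coset p) = g b p" if "b \<in> B - C" for b p
  proof -
    have "coset p = coset (SOME p'. coset p = coset p')" by (rule someI) simp
    then show ?thesis
      using g_eq[OF that, of p "SOME p'. coset p = coset p'"] that
      by (simp add: d_def carrier_Q the_inv_into_f_f[OF inj that] coset_eq_iff)
  qed
  show thesis
  proof (rule that[of "coset ` (B - C)" d], unfold_locales, unfold module_extend_simps)
    show "finite (coset ` (B - C))" using fin by simp
    show "coset ` (B - C) \<subseteq> carrier Q" by (auto simp: carrier_Q)
    show "d e \<in> carrier (dual_algebra (module.extend Q X))" if e: "e \<in> coset ` (B - C)" for e
    proof -
      obtain b where b: "b \<in> B - C" "e = coset b" using e by blast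
      have "linear_form Q (d e)" unfolding linear_form_Q_iff b(2) d[OF b(1)] by (rule lin)
      then show ?thesis
        unfolding carrier_dual_algebra module_extend_simps by (simp add: d_def)
    qed
    show "bilinear_form (module.extend Q X) (module.extend Q X) (\<lambda>h h'. f (h \<otimes>\<^bsub>Q\<^esub> h'))"
      if "linear_form Q f" for f
      using mult_bilinear_Q[OF that] unfolding bilinear_form_def module_extend_simps .
    show "f h = (\<Sum>e\<in>coset ` (B - C). f e * d e h)"
      if f: "linear_form Q f" and h: "h \<in> carrier Q" for f h
    proof -
      obtain p where p: "h = coset p" using h by (auto simp: carrier_Q)
      have lf: "Vector_Spaces.linear (*s) (*) (\<lambda>p. f (coset p))"
        using f by (simp add: linear_form_Q_iff)
      interpret lf: Vector_Spaces.linear "(*s)" "(*)" "\<lambda>p. f (coset p)" by (rule lf)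
      \<comment> \<open>\<open>p\<close> and its expansion differ by an element of \<open>I\<close>,
        so they have the same coset.\<close>
      have "f h = f (coset (\<Sum>b\<in>B - C. g b p *s b))"
        using expand[of p] by (simp only: p) (metis coset_eq_iff)
      also have "\<dots> = (\<Sum>b\<in>B - C. f (coset b) * d (coset b) h)"
        by (simp add: lf.sum lf.scale p d mult.commute)
      finally show ?thesis by (simp add: sum.reindex[OF inj])
    qed
  qed
qed

text \<open>The assumptions on \<open>S\<close> express that the quotient is
  finite-dimensional.\<close>

lemma carrier_grouplikes_dual_Q:
  assumes "finite S" and "span (S \<union> I) = UNIV"
  shows "carrier (grouplikes (dual_hopf (module.extend Q X))) =
    {f. linear_form Q f \<and> (\<forall>h. h \<notin> carrier Q \<longrightarrow> f h = 0) \<and> f (coset 1) = 1 \<and>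
      (\<forall>u v. f (coset (u * v)) = f (coset u) * f (coset v))}"
proof -
  obtain E d where "dual_bases (module.extend Q X) E d"
    using ex_dual_bases_Q[OF assms] .
  then interpret dual_bases "module.extend Q X" E d .
  show ?thesis
    unfolding carrier_grouplikes_dual carrier_dual_algebra module_extend_simps
    by (simp add: carrier_Q mult_Q one_Q conj_assoc)
qed

text \<open>Composition with \<open>coset\<close> matches characters of the quotient with characters
  of the original algebra that vanish on \<open>I\<close>; the count is thereby moved away from
  cosets.\<close>

lemma card_grouplikes_dual_Q:
  assumes "finite S" and "span (S \<union> I) = UNIV"
  shows "order (grouplikes (dual_hopf (module.extend Q X))) =
    card {\<chi>. Vector_Spaces.linear (*s) (*) \<chi> \<and> \<chi> 1 = 1 \<and> (\<forall>u v. \<chi> (u * v) = \<chi> u * \<chi> v) \<and>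
      (\<forall>u\<in>I. \<chi> u = 0)}"
    (is "_ = card ?C")
proof -
  let ?G = "{f. linear_form Q f \<and> (\<forall>h. h \<notin> carrier Q \<longrightarrow> f h = 0) \<and> f (coset 1) = 1 \<and>
      (\<forall>u v. f (coset (u * v)) = f (coset u) * f (coset v))}"
  have "bij_betw (\<lambda>f p. f (coset p)) (carrier (grouplikes (dual_hopf (module.extend Q X)))) ?C"
    unfolding carrier_grouplikes_dual_Q[OF assms]
  proof (rule bij_betwI')
    fix f g
    assume *: "f \<in> ?G" "g \<in> ?G"
    show "(\<lambda>p. f (coset p)) = (\<lambda>p. g (coset p)) \<longleftrightarrow> f = g"
    proof
      assume "(\<lambda>p. f (coset p)) = (\<lambda>p. g (coset p))"
      then have "f h = g h" for h
        using * by (cases "h \<in> carrier Q") (auto simp: carrier_Q dest: fun_cong)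
      then show "f = g" ..
    qed simp
  next
    fix f
    assume *: "f \<in> ?G"
    then have lin: "Vector_Spaces.linear (*s) (*) (\<lambda>p. f (coset p))"
      by (simp add: linear_form_Q_iff)
    interpret lf: Vector_Spaces.linear "(*s)" "(*)" "\<lambda>p. f (coset p)" by (rule lin)
    have "f (coset u) = 0" if "u \<in> I" for u
      using that lf.zero coset_eq_iff[of u 0] by simp
    with * lin show "(\<lambda>p. f (coset p)) \<in> ?C" by simp
  next
    fix \<chi> assume \<chi>: "\<chi> \<in> ?C"
    interpret \<chi>: Vector_Spaces.linear "(*s)" "(*)" \<chi> using \<chi> by simp
    \<comment> \<open>The inverse correspondence: a character that vanishes on \<open>I\<close> is
      constant on cosets, so any representative may be chosen.\<close>
    define f where "f = (\<lambda>h. if h \<in> carrier Q then \<chi> (SOME p. h = coset p) else 0)"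
    have f: "f (coset p) = \<chi> p" for p
    proof -
      have "coset p = coset (SOME p'. coset p = coset p')" by (rule someI) simp
      then have "\<chi> (p - (SOME p'. coset p = coset p')) = 0"
        using \<chi> unfolding coset_eq_iff by blast
      then show ?thesis by (simp add: f_def carrier_Q \<chi>.diff)
    qed
    show "\<exists>f\<in>?G. \<chi> = (\<lambda>p. f (coset p))"
      by (rule bexI[of _ f], simp add: f) (use \<chi> in \<open>simp add: linear_form_Q_iff f, simp add: f_def\<close>)
  qed
  then show ?thesis unfolding order_def by (rule bij_betw_same_card)
qed

end

section \<open>The free algebra and its characters\<close>

lemma scalar_0 [simp]: "scalar 0 = 0" and scalar_1 [simp]: "scalar 1 = 1"
  by (simp_all add: scalar_def)

lemma scalar_mult: "scalar (c * d) = scalar c * scalar d"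
  by (simp add: scalar_def mult_single)

lemma scalar_add: "scalar (c + d) = scalar c + scalar d"
  by (simp add: scalar_def single_add)

lemma scalar_mult_single: "scalar c * Poly_Mapping.single w d = Poly_Mapping.single w (c * d)"
  by (simp add: scalar_def mult_single)

lemma free_alg_single_induct [case_names zero add]:
  fixes p :: "'k::field free_alg"
  assumes "P 0" and add: "\<And>p w c. P p \<Longrightarrow> P (p + Poly_Mapping.single w c)"
  shows "P p"
proof (induction p rule: update_induct)
  case const
  show ?case by fact
next
  case (update f a b)
  \<comment> \<open>The key \<open>a\<close> is new, so its coefficient in \<open>f\<close> is 0 and
    the update is an addition.\<close>
  have "Poly_Mapping.update a b f = f + Poly_Mapping.single a b"
    using update(1)
    by (intro poly_mapping_eqI)
      (auto simp: lookup_update lookup_add lookup_single when_def in_keys_iff)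
  then show ?case using add[OF update(3)] by simp
qed

text \<open>Every word arises from 1 by successive left multiplication by generators, and words span
  the free algebra.\<close>

lemma free_alg_induct [case_names one generator add scalar]:
  fixes p :: "'k::field free_alg"
  assumes one: "P 1" and generator: "\<And>g p. P p \<Longrightarrow> P (generator g * p)"
    and add: "\<And>p p'. P p \<Longrightarrow> P p' \<Longrightarrow> P (p + p')" and scalar: "\<And>c p. P p \<Longrightarrow> P (scalar c * p)"
  shows "P p"
proof -
  have word: "P (Poly_Mapping.single (Word gs) 1)" for gs
  proof (induction gs)
    case Nil
    then show ?case using one by (simp flip: zero_word_def)
  next
    case (Cons g gs)
    have "Poly_Mapping.single (Word (g # gs)) (1::'k) = generator g * Poly_Mapping.single (Word gs) 1"
      by (simp add: generator_def mult_single plus_word_def)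
    then show ?case using generator[OF Cons] by simp
  qed
  have "P (Poly_Mapping.single w c)" for w c
    using scalar[OF word[of "letters w"], of c] by (simp add: scalar_mult_single)
  moreover have "P 0" using scalar[OF one, of 0] by simp
  ultimately show ?thesis by (induction p rule: free_alg_single_induct) (auto intro: add)
qed

lemma scalar_commute: "p * scalar c = scalar c * p"
proof (induction p rule: free_alg_single_induct)
  case (add p w d)
  have "Poly_Mapping.single w d * scalar c = scalar c * Poly_Mapping.single w d"
    by (simp add: scalar_def mult_single mult.commute)
  then show ?case using add by (simp add: distrib_left distrib_right)
qed simp

lemma vector_space_free_alg: "vector_space (\<lambda>c p. scalar c * p)"
  by unfold_locales (simp_all add: distrib_left distrib_right scalar_add scalar_mult mult.assoc)

lemma letters_zero: "letters 0 = []"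
  by (simp add: zero_word_def)

text \<open>The algebra homomorphism to the ground field that sends each generator \<open>g\<close>
  to \<open>\<gamma> g\<close>: evaluation of noncommutative polynomials at scalars.\<close>

definition free_character :: "(gen \<Rightarrow> 'k) \<Rightarrow> 'k::field free_alg \<Rightarrow> 'k" where
  "free_character \<gamma> p =
    (\<Sum>w\<in>Poly_Mapping.keys p. Poly_Mapping.lookup p w * prod_list (map \<gamma> (letters w)))"

text \<open>Gives polynomials with different supports a common index set.\<close>

lemma free_character_superset:
  assumes "finite A" "Poly_Mapping.keys p \<subseteq> A"
  shows "free_character \<gamma> p = (\<Sum>w\<in>A. Poly_Mapping.lookup p w * prod_list (map \<gamma> (letters w)))"
  unfolding free_character_def
  using assms by (intro sum.mono_neutral_left) (auto simp: in_keys_iff)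

lemma free_character_add: "free_character \<gamma> (p + p') = free_character \<gamma> p + free_character \<gamma> p'"
proof -
  let ?A = "Poly_Mapping.keys p \<union> Poly_Mapping.keys p'"
  have "free_character \<gamma> r = (\<Sum>w\<in>?A. Poly_Mapping.lookup r w * prod_list (map \<gamma> (letters w)))"
    if "r = p \<or> r = p' \<or> r = p + p'" for r
    using that Poly_Mapping.keys_add[of p p'] by (intro free_character_superset) auto
  then show ?thesis by (simp add: lookup_add distrib_right sum.distrib)
qed

lemma free_character_single:
  "free_character \<gamma> (Poly_Mapping.single w c) = c * prod_list (map \<gamma> (letters w))"
  by (simp add: free_character_superset[of "{w}"])

lemma free_character_0: "free_character \<gamma> 0 = 0"
  by (simp add: free_character_def)

lemma free_character_1: "free_character \<gamma> 1 = 1"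
  using free_character_single[of \<gamma> 0 1] by (simp add: letters_zero)

text \<open>Multiplicativity is reduced to monomials one factor at a time; for two monomials it
  holds because concatenated words give products of values.\<close>

lemma free_character_single_mult:
  "free_character \<gamma> (Poly_Mapping.single w c * p) =
    free_character \<gamma> (Poly_Mapping.single w c) * free_character \<gamma> p"
proof (induction p rule: free_alg_single_induct)
  case (add p w' d)
  then show ?case
    by (simp add: distrib_left free_character_add free_character_single mult_single plus_word_def)
qed (simp add: free_character_0)

lemma free_character_mult: "free_character \<gamma> (p * p') = free_character \<gamma> p * free_character \<gamma> p'"
  by (induction p rule: free_alg_single_induct)
    (simp_all add: free_character_0 free_character_add free_character_single_mult distrib_right)

lemma free_character_scalar: "free_character \<gamma> (scalar c) = c"
  by (simp add: scalar_def free_character_single letters_zero)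

lemma free_character_generator: "free_character \<gamma> (generator g) = \<gamma> g"
  by (simp add: generator_def free_character_single)

lemma linear_free_character:
  "Vector_Spaces.linear (\<lambda>c p. scalar c * p) (*) (free_character (\<gamma> :: gen \<Rightarrow> 'k::field))"
proof -
  have "vector_space ((*) :: 'k \<Rightarrow> 'k \<Rightarrow> 'k)" by unfold_locales (simp_all add: algebra_simps)
  then show ?thesis
    using vector_space_free_alg
    by (simp add: Vector_Spaces.linear_iff free_character_add free_character_mult free_character_scalar)
qed

text \<open>Both sides are linear and multiplicative and agree at 1 and on generators, which is all
  that \<open>free_alg_induct\<close> asks for.\<close>

lemma free_algebra_character_eq:
  assumes "Vector_Spaces.linear (\<lambda>c p. scalar c * p) (*) \<chi>" "\<chi> 1 = 1"
    "\<And>p p'. \<chi> (p * p') = \<chi> p * \<chi> p'"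
  shows "\<chi> = free_character (\<lambda>g. \<chi> (generator g))"
proof
  interpret \<chi>: Vector_Spaces.linear "\<lambda>c p. scalar c * p" "(*)" \<chi> by fact
  show "\<chi> p = free_character (\<lambda>g. \<chi> (generator g)) p" for p
  proof (induction p rule: free_alg_induct)
    case (generator g p)
    then show ?case by (simp only: assms(3) free_character_mult free_character_generator)
  next
    case (scalar c p)
    then show ?case by (simp only: \<chi>.scale free_character_mult free_character_scalar)
  next
    case (add p p')
    then show ?case by (simp only: \<chi>.add free_character_add)
  qed (simp add: assms(2) free_character_1)
qed

lemma free_character_power: "free_character \<gamma> (p ^ m) = free_character \<gamma> p ^ m"
  by (induction m) (simp_all add: free_character_1 free_character_mult)

lemma free_character_diff: "free_character \<gamma> (p - p') = free_character \<gamma> p - free_character \<gamma> p'"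
  using free_character_add[of \<gamma> "p - p'" p'] by simp

lemma genideal_self_free: "R \<subseteq> Idl\<^bsub>free_algebra\<^esub> R"
  unfolding free_algebra_def by (rule ring.genideal_self[OF ring_type_algebra]) simp

text \<open>The kernel of a ring homomorphism is an ideal, so it contains the ideal generated by
  \<open>R\<close> as soon as it contains \<open>R\<close>.\<close>

lemma free_character_vanishes_genideal_iff:
  fixes \<gamma> :: "gen \<Rightarrow> 'k::field"
  shows "(\<forall>p\<in>Idl\<^bsub>free_algebra\<^esub> R. free_character \<gamma> p = 0) \<longleftrightarrow> (\<forall>p\<in>R. free_character \<gamma> p = 0)"
proof
  assume *: "\<forall>p\<in>R. free_character \<gamma> p = 0"
  let ?K = "type_algebra ((*) :: 'k \<Rightarrow> 'k \<Rightarrow> 'k)"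
  have ring: "ring (free_algebra :: ('k, 'k free_alg) module)"
    unfolding free_algebra_def by (rule ring_type_algebra)
  have hom: "ring_hom_ring free_algebra ?K (free_character \<gamma>)"
    by (intro ring_hom_ringI2 ring ring_type_algebra ring_hom_memI)
      (simp_all add: free_algebra_def free_character_add free_character_mult free_character_1)
  have kernel: "a_kernel free_algebra ?K (free_character \<gamma>) = {p. free_character \<gamma> p = 0}"
    unfolding a_kernel_def' free_algebra_def by simp
  have "Idl\<^bsub>free_algebra\<^esub> R \<subseteq> a_kernel free_algebra ?K (free_character \<gamma>)"
    by (rule ring.genideal_minimal[OF ring ring_hom_ring.kernel_is_ideal[OF hom]])
      (use * in \<open>auto simp: kernel\<close>)
  then show "\<forall>p\<in>Idl\<^bsub>free_algebra\<^esub> R. free_character \<gamma> p = 0"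
    by (auto simp: kernel)
qed (use genideal_self_free in blast)

section \<open>Roots of unity\<close>

text \<open>Division with remainder replaces \<open>m\<close> by \<open>m mod N\<close>, and no
  positive exponent below \<open>N\<close> gives 1.\<close>

lemma primitive_root_power_eq_1_iff:
  assumes "primitive_root_of_unity N \<omega>"
  shows "\<omega> ^ m = 1 \<longleftrightarrow> N dvd m"
proof -
  have "\<omega> ^ m = \<omega> ^ (N * (m div N) + m mod N)" by simp
  also have "\<dots> = \<omega> ^ (m mod N)"
    using assms by (simp only: power_add power_mult) (simp add: primitive_root_of_unity_def)
  finally show ?thesis
    using assms by (auto simp: primitive_root_of_unity_def dvd_eq_mod_eq_0)
qed

text \<open>The \<open>N\<close> powers are distinct roots of the polynomial \<open>p\<close> below,
  which has degree at most \<open>N\<close> and so has no other roots.\<close>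

lemma bij_betw_primitive_root_powers:
  fixes \<omega> :: "'k::field"
  assumes \<omega>: "primitive_root_of_unity N \<omega>"
  shows "bij_betw ((^) \<omega>) {..<N} {u. u ^ N = 1}"
proof -
  have N: "0 < N" and \<omega>0: "\<omega> \<noteq> 0" using \<omega> by (auto simp: primitive_root_of_unity_def power_0_left)
  have lt: "\<omega> ^ i \<noteq> \<omega> ^ j" if "i < j" "j < N" for i j
  proof
    assume "\<omega> ^ i = \<omega> ^ j"
    also have "\<dots> = \<omega> ^ i * \<omega> ^ (j - i)" using that by (simp flip: power_add)
    finally have "\<omega> ^ (j - i) = 1" using \<omega>0 by simp
    then show False using \<omega> that by (auto simp: primitive_root_of_unity_def)
  qed
  have inj: "inj_on ((^) \<omega>) {..<N}"
    by (rule inj_onI) (metis lessThan_iff linorder_neqE_nat lt)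
  define p where "p = monom (1::'k) N - 1"
  have "coeff p N = 1" using N by (simp add: p_def)
  then have "p \<noteq> 0" by auto
  have "degree p \<le> N" unfolding p_def by (intro degree_diff_le) (simp_all add: degree_monom_le)
  have roots: "{u. poly p u = 0} = {u. u ^ N = 1}" by (simp add: p_def poly_monom)
  have fin: "finite {u::'k. u ^ N = 1}" using poly_roots_finite[OF \<open>p \<noteq> 0\<close>] roots by simp
  have "card {u::'k. u ^ N = 1} \<le> N"
    using card_poly_roots_bound[OF \<open>p \<noteq> 0\<close>] \<open>degree p \<le> N\<close> roots by simp
  moreover have sub: "(^) \<omega> ` {..<N} \<subseteq> {u. u ^ N = 1}"
    using primitive_root_power_eq_1_iff[OF \<omega>] by (auto simp flip: power_mult)
  ultimately have "(^) \<omega> ` {..<N} = {u. u ^ N = 1}"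
    using card_seteq[OF fin sub] by (simp add: card_image[OF inj])
  with inj show ?thesis by (simp add: bij_betw_def)
qed

text \<open>The exponent \<open>n\<close> shows that the minimum in \<open>mult_order\<close> is
  over a nonempty set.\<close>

lemma mult_order_pos:
  assumes "primitive_root_of_unity n q"
  shows "0 < mult_order (q ^ \<nu>)"
proof -
  have "0 < n \<and> (q ^ \<nu>) ^ n = 1"
    using assms power_mult[of q n \<nu>] power_mult[of q \<nu> n]
    by (simp add: primitive_root_of_unity_def mult.commute)
  then show ?thesis unfolding mult_order_def by (rule LeastI2) simp
qed

section \<open>The algebra $H_{n,q,N,\nu,\alpha}$\<close>

locale H_presentation =
  fixes n N \<nu> :: nat and q \<alpha> :: "'k::field"
  assumes n_pos: "0 < n" and N_pos: "0 < N"
    and q: "primitive_root_of_unity n q"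
    and n_gt_1: "\<alpha> \<noteq> 0 \<Longrightarrow> n > 1"
begin

abbreviation "a \<equiv> (generator GenA :: 'k free_alg)"
abbreviation "x \<equiv> (generator GenX :: 'k free_alg)"
abbreviation "I \<equiv> H_ideal n q N \<nu> \<alpha>"

text \<open>With this exponent the last relation reads
  \<open>x ^ m = \<alpha> (a ^ (\<nu> * n) - 1)\<close> in both cases, since the right side vanishes
  for \<open>\<alpha> = 0\<close>.\<close>

definition "m = (if \<alpha> = 0 then mult_order (q ^ \<nu>) else n)"

lemma m_pos: "0 < m"
  using mult_order_pos[OF q] n_pos by (simp add: m_def)

sublocale algebra_quotient "\<lambda>c p. scalar c * p" I
proof (intro algebra_quotient.intro vector_space_free_alg algebra_quotient_axioms.intro)
  show "ideal I (type_algebra (\<lambda>c p. scalar c * p))"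
    unfolding H_ideal_def free_algebra_def
    by (intro ring.genideal_ideal ring_type_algebra) simp
  show "u * (scalar c * v) = scalar c * (u * v)" for u v and c :: 'k
    by (metis mult.assoc scalar_commute)
qed (simp add: mult.assoc)

lemma relations_in_ideal: "a ^ N - 1 \<in> I" "x * a - scalar q * a * x \<in> I"
    "x ^ m - scalar \<alpha> * (a ^ (\<nu> * n) - 1) \<in> I"
  using genideal_self_free[of "H_relations n q N \<nu> \<alpha>"]
  by (auto simp: H_ideal_def H_relations_def m_def Let_def)

text \<open>\<open>W\<close> is all of the free algebra because it contains 1 and is stable under left multiplication
  by the generators; hence the monomials \<open>a\<^sup>i x\<^sup>j\<close> span the quotient.\<close>

abbreviation "W \<equiv> span ((\<lambda>(i, j). a ^ i * x ^ j) ` ({..<N} \<times> {..<m}) \<union> I)"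

lemma span_cong_ideal:
  assumes "p - p' \<in> I" "p' \<in> W"
  shows "p \<in> W"
proof -
  have "p - p' \<in> W" using assms(1) by (auto intro: span_base)
  from span_add[OF this assms(2)] show ?thesis by simp
qed

lemma ideal_mult_both: "p \<in> I \<Longrightarrow> u * p * v \<in> I"
  by (intro ideal_mult_left ideal_mult_right)

text \<open>Modulo \<open>I\<close> the exponent of \<open>a\<close> can be lowered by
  \<open>N\<close> until it is below \<open>N\<close>.\<close>

lemma monomial_in_span: "j < m \<Longrightarrow> a ^ k * x ^ j \<in> W"
proof (induction k rule: less_induct)
  case (less k)
  show ?case
  proof (cases "k < N")
    case True
    then show ?thesis using less.prems by (intro span_base) auto
  next
    case False
    have "a ^ k = a ^ (k - N) * a ^ N" using False by (simp flip: power_add)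
    then have "a ^ k * x ^ j - a ^ (k - N) * x ^ j = a ^ (k - N) * (a ^ N - 1) * x ^ j"
      by (simp add: algebra_simps)
    then have "a ^ k * x ^ j - a ^ (k - N) * x ^ j \<in> I"
      using ideal_mult_both[OF relations_in_ideal(1)] by simp
    moreover have "a ^ (k - N) * x ^ j \<in> W" using less False N_pos by auto
    ultimately show ?thesis by (rule span_cong_ideal)
  qed
qed

text \<open>Each step of \<open>x\<close> past one \<open>a\<close> contributes a factor
  \<open>q\<close>; the error terms are multiples of the relation \<open>xa = qax\<close> and stay
  in \<open>I\<close>.\<close>

lemma x_a_power: "x * a ^ i - scalar (q ^ i) * a ^ i * x \<in> I"
proof (induction i)
  case 0
  then show ?case using subspace_0[OF subspace_ideal] by simp
next
  case (Suc i)
  have "x * a ^ Suc i - scalar (q ^ Suc i) * a ^ Suc i * x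
    = (x * a ^ i - scalar (q ^ i) * a ^ i * x) * a
      + scalar (q ^ i) * a ^ i * (x * a - scalar q * a * x)"
  proof -
    have "scalar (q ^ Suc i) * a ^ Suc i = scalar (q ^ i) * a ^ i * (scalar q * a)"
      by (metis mult.assoc power_Suc2 scalar_commute scalar_mult)
    then show ?thesis by (simp only: power_Suc2) (simp add: algebra_simps)
  qed
  then show ?case
    using ideal_add[OF ideal_mult_right[OF Suc] ideal_mult_left[OF relations_in_ideal(2)]] by simp
qed

text \<open>Multiplying by \<open>x\<close> can raise the exponent of \<open>x\<close> to
  \<open>m\<close> but no further; the last relation then leads back to powers of \<open>a\<close>
  alone.\<close>

lemma monomial_m_in_span: "a ^ i * x ^ m \<in> W"
proof (rule span_cong_ideal)
  show "a ^ i * x ^ m - scalar \<alpha> * (a ^ (i + \<nu> * n) - a ^ i) \<in> I"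
  proof -
    have "a ^ i * x ^ m - scalar \<alpha> * (a ^ (i + \<nu> * n) - a ^ i)
        = a ^ i * (x ^ m - scalar \<alpha> * (a ^ (\<nu> * n) - 1))"
      by (simp only: right_diff_distrib[of "a ^ i"] mult_scale_right power_add mult_1_right)
    then show ?thesis using ideal_mult_left[OF relations_in_ideal(3)] by simp
  qed
  show "scalar \<alpha> * (a ^ (i + \<nu> * n) - a ^ i) \<in> W"
    using monomial_in_span[of 0] m_pos by (intro span_scale span_diff) auto
qed

lemma generator_mult_in_span:
  assumes "p \<in> W"
  shows "generator g * p \<in> W"
proof -
  \<comment> \<open>The preimage of \<open>W\<close> under left multiplication is a subspace, so it
    suffices to treat the spanning monomials and \<open>I\<close>.\<close>
  have "subspace {p. generator g * p \<in> W}"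
    by (auto simp: subspace_def distrib_left mult_scale_right span_zero intro: span_add span_scale)
  moreover have "generator g * (a ^ i * x ^ j) \<in> W" if "i < N" "j < m" for i j
  proof (cases g)
    case GenA
    then show ?thesis using monomial_in_span[OF \<open>j < m\<close>, of "Suc i"] by (simp add: mult.assoc)
  next
    case GenX
    have "x * (a ^ i * x ^ j) - scalar (q ^ i) * (a ^ i * x ^ Suc j)
        = (x * a ^ i - scalar (q ^ i) * a ^ i * x) * x ^ j"
      by (simp add: algebra_simps)
    then have "x * (a ^ i * x ^ j) - scalar (q ^ i) * (a ^ i * x ^ Suc j) \<in> I"
      using ideal_mult_right[OF x_a_power] by simp
    moreover have "a ^ i * x ^ Suc j \<in> W"
      using monomial_in_span[of "Suc j" i] monomial_m_in_span[of i] \<open>j < m\<close>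
      by (cases "Suc j = m") auto
    ultimately show ?thesis using GenX by (auto intro: span_cong_ideal span_scale)
  qed
  moreover have "generator g * p \<in> W" if "p \<in> I" for p
    using ideal_mult_left[OF that] by (auto intro: span_base)
  ultimately have "W \<subseteq> {p. generator g * p \<in> W}"
    by (intro span_minimal) auto
  then show ?thesis using assms by blast
qed

lemma W_eq_UNIV: "W = UNIV"
proof -
  have "p \<in> W" for p
  proof (induction p rule: free_alg_induct)
    case one
    then show ?case using monomial_in_span[of 0 0] m_pos by simp
  qed (intro generator_mult_in_span span_add span_scale; assumption)+
  then show ?thesis by blast
qed

lemma order_grouplikes:
  "order (grouplikes (dual_hopf (H_hopf n q N \<nu> \<alpha>)))
    = card {u::'k. u ^ N = 1 \<and> (\<alpha> \<noteq> 0 \<longrightarrow> u ^ (\<nu> * n) = 1)}"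
proof -
  have kill_iff: "(\<forall>p\<in>I. free_character \<gamma> p = 0) \<longleftrightarrow>
      \<gamma> GenX = 0 \<and> \<gamma> GenA ^ N = 1 \<and> (\<alpha> \<noteq> 0 \<longrightarrow> \<gamma> GenA ^ (\<nu> * n) = 1)" for \<gamma>
  proof -
    have "(\<forall>p\<in>I. free_character \<gamma> p = 0) \<longleftrightarrow> \<gamma> GenA ^ N = 1 \<and>
        \<gamma> GenX * \<gamma> GenA = q * \<gamma> GenA * \<gamma> GenX \<and>
        (if \<alpha> = 0 then \<gamma> GenX ^ mult_order (q ^ \<nu>) = 0
         else \<gamma> GenX ^ n = \<alpha> * (\<gamma> GenA ^ (\<nu> * n) - 1))"
      unfolding H_ideal_def free_character_vanishes_genideal_iff
      by (simp add: H_relations_def Let_def free_character_diff free_character_power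
          free_character_mult free_character_1 free_character_scalar free_character_generator mult.assoc)
    \<comment> \<open>In a field the commutation relation says that \<open>1 - q\<close> times both
      values is 0; here \<open>q\<close> differs from 1 and the value at \<open>a\<close> is
      invertible.\<close>
    moreover have "\<gamma> GenX = 0" if "\<alpha> \<noteq> 0" "\<gamma> GenA ^ N = 1"
      "\<gamma> GenX * \<gamma> GenA = q * \<gamma> GenA * \<gamma> GenX"
    proof -
      have "q \<noteq> 1" using q n_gt_1[OF \<open>\<alpha> \<noteq> 0\<close>] by (auto simp: primitive_root_of_unity_def)
      moreover have "\<gamma> GenA \<noteq> 0" using that N_pos by (auto simp: power_0_left)
      ultimately show ?thesis using that(3) by auto
    qed
    \<comment> \<open>Positive exponents matter here: for \<open>\<alpha> = 0\<close> a vanishing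
      power forces the value at \<open>x\<close> to be 0, and conversely 0 satisfies the power
      relation.\<close>
    ultimately show ?thesis
      using mult_order_pos[OF q, of \<nu>] n_pos by (auto simp: power_0_left)
  qed
  \<comment> \<open>\<open>X\<close> collects comultiplication, counit and antipode, so that
    \<open>H_hopf\<close> takes the form in \<open>card_grouplikes_dual_Q\<close>.\<close>
  obtain X where X: "H_hopf n q N \<nu> \<alpha> = module.extend Q X"
    unfolding H_hopf_def H_algebra_def free_algebra_def Let_def by blast
  let ?C = "{\<chi>. Vector_Spaces.linear (\<lambda>c p. scalar c * p) (*) \<chi> \<and> \<chi> 1 = 1 \<and>
      (\<forall>u v. \<chi> (u * v) = \<chi> u * \<chi> v) \<and> (\<forall>u\<in>I. \<chi> u = 0)}"
  let ?U = "{u::'k. u ^ N = 1 \<and> (\<alpha> \<noteq> 0 \<longrightarrow> u ^ (\<nu> * n) = 1)}"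
  let ?\<gamma> = "\<lambda>u g. case g of GenA \<Rightarrow> u | GenX \<Rightarrow> (0 :: 'k)"
  have eq: "\<chi> = free_character (?\<gamma> (\<chi> a)) \<and> \<chi> a \<in> ?U" if "\<chi> \<in> ?C" for \<chi>
  proof -
    have \<chi>: "\<chi> = free_character (\<lambda>g. \<chi> (generator g))"
      using that by (intro free_algebra_character_eq) auto
    have "\<forall>p\<in>I. free_character (\<lambda>g. \<chi> (generator g)) p = 0"
      using that by (subst \<chi>[symmetric]) simp
    then have "\<chi> x = 0" "\<chi> a \<in> ?U" unfolding kill_iff by simp_all
    moreover from \<open>\<chi> x = 0\<close> have "(\<lambda>g. \<chi> (generator g)) = ?\<gamma> (\<chi> a)"
      by (auto simp: fun_eq_iff split: gen.split)
    ultimately show ?thesis using \<chi> by simp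
  qed
  \<comment> \<open>A character that vanishes on \<open>I\<close> is 0 at \<open>x\<close>, so its
    value at \<open>a\<close> determines it; the inverse extends \<open>u\<close> by 0 at
    \<open>x\<close>.\<close>
  have "bij_betw (\<lambda>\<chi>. \<chi> a) ?C ?U"
  proof (rule bij_betwI[where g = "\<lambda>u. free_character (?\<gamma> u)"])
    show "(\<lambda>u. free_character (?\<gamma> u)) \<in> ?U \<rightarrow> ?C"
      by (auto simp: linear_free_character free_character_1 free_character_mult kill_iff)
  qed (use eq in \<open>auto simp: free_character_generator\<close>)
  then have "card ?C = card ?U" by (rule bij_betw_same_card)
  then show ?thesis
    unfolding X by (simp add: card_grouplikes_dual_Q[OF _ W_eq_UNIV])
qed

end

section \<open>Counting the admissible values of \<open>a\<close> by exponents of a primitive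
  root\<close>

theorem lemma2p2:
  fixes n N \<nu> :: nat and q \<alpha> :: "'k::field"
  assumes "0 < n" and "0 < \<nu>" and "0 < N"
    and "n dvd N" and "1 \<le> \<nu>" and "\<nu> < N"
    and "primitive_root_of_unity n q"
    and "\<alpha> \<noteq> 0 \<Longrightarrow> coprime n \<nu> \<and> n > 1 \<and> \<not> N dvd \<nu> * n"
    and "\<exists>\<omega>::'k. primitive_root_of_unity N \<omega>"
  shows "(\<alpha> = 0 \<longrightarrow> order (grouplikes (dual_hopf (H_hopf n q N \<nu> \<alpha>))) = N) \<and>
    (\<alpha> \<noteq> 0 \<longrightarrow> order (grouplikes (dual_hopf (H_hopf n q N \<nu> \<alpha>))) =
       card {i. 0 \<le> i \<and> i \<le> N - 1 \<and> N dvd \<nu> * n * i})"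
proof -
  obtain \<omega> :: 'k where \<omega>: "primitive_root_of_unity N \<omega>" using assms(9) by blast
  interpret H_presentation n N \<nu> q \<alpha>
    using assms by unfold_locales auto
  note b = bij_betw_primitive_root_powers[OF \<omega>]
  let ?J = "{i. 0 \<le> i \<and> i \<le> N - 1 \<and> N dvd \<nu> * n * i}"
  have iff: "(\<omega> ^ i) ^ (\<nu> * n) = 1 \<longleftrightarrow> N dvd \<nu> * n * i" for i
    using primitive_root_power_eq_1_iff[OF \<omega>, of "\<nu> * n * i"]
    by (simp add: mult.commute flip: power_mult)
  \<comment> \<open>Subtraction is truncated, so this equivalence relies on
    \<open>0 < N\<close>.\<close>
  have "i \<le> N - 1 \<longleftrightarrow> i < N" for i using \<open>0 < N\<close> by linarith
  then have J: "?J = {i \<in> {..<N}. N dvd \<nu> * n * i}" by simp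
  have "{u::'k. u ^ N = 1 \<and> u ^ (\<nu> * n) = 1} = {u \<in> (^) \<omega> ` {..<N}. u ^ (\<nu> * n) = 1}"
    unfolding bij_betw_imp_surj_on[OF b] by simp
  also have "\<dots> = (^) \<omega> ` {i \<in> {..<N}. (\<omega> ^ i) ^ (\<nu> * n) = 1}"
    by auto
  also have "\<dots> = (^) \<omega> ` ?J"
    unfolding iff J ..
  finally have "{u::'k. u ^ N = 1 \<and> u ^ (\<nu> * n) = 1} = (^) \<omega> ` ?J" .
  moreover have "inj_on ((^) \<omega>) ?J"
    using bij_betw_imp_inj_on[OF b] by (rule inj_on_subset) (unfold J, blast)
  ultimately have "card {u::'k. u ^ N = 1 \<and> u ^ (\<nu> * n) = 1} = card ?J"
    by (simp add: card_image)
  then show ?thesis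
    using order_grouplikes bij_betw_same_card[OF b] by auto
qed

end
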